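(* For any given adapted policy $z_{0:T}$, the value process $\bigl(v_t(z_{0:t-1}\mid\cdot)\bigr)_{t=0}^T$ of the risk-averse multistage problem, as defined in the context, is an $\mathcal R$-submartingale, i.e. $$v_t(z_{0:t-1}\mid x_{1:t})\le\mathcal R_{\mathcal S_{t+1}}\bigl(v_{t+1}(z_{0:t}\mid\cdot)\mid x_{1:t}\bigr)\quad\text{a.s.},\qquad t=0,\dots,T-1.$$
   Context: Spaces: $T\ge1$; $\Xi_t$, $t=1,\dots,T$, are Polish spaces; $\Xi=\Xi_{1:T}:=\Xi_1\times\dots\times\Xi_T$, elements $x_{1:T}=(x_1,\dots,x_T)$, $x_{1:t}=(x_1,\dots,x_t)$, $x_{1:0}$ the empty tuple; $P$ is a Borel probability measure on $\Xi$; $\mathcal F_t$ is the sigma algebra generated by $x\mapsto x_{1:t}$, $\mathcal F_0$ trivial; $P(\cdot\mid x_{1:t})$ is the regular conditional probability on $\Xi_{t+1}\times\dots\times\Xi_T$ given the first $t$ coordinates. Risk functionals: a distortion function is a nondecreasing $\sigma\colon[0,1)\to[0,\infty)$ with $\int_0^1\sigma(u)\,du=1$. For $\alpha\in[0,1)$, $\mathsf{AV@R}_{\alpha;P}(Y):=\inf_{c\in\mathbb R}\{c+\frac1{1-\alpha}\mathbb E_P(Y-c)_+\}$, and $$\mathcal R_{\sigma;P}(Y):=\sup\Big\{\mathbb E_P Y\zeta:\ \zeta\ge0,\ \mathbb E_P\zeta=1,\ \mathsf{AV@R}_{\alpha;P}(\zeta)\le\tfrac1{1-\alpha}\int_\alpha^1\sigma(u)\,du\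 \text{ for all }\alpha\in(0,1)\Big\}.$$ $\mathcal S_1,\dots,\mathcal S_T$ are collections of distortion functions. The conditional risk measure is $\mathcal R_{\mathcal S_{t+1}}(Y\mid x_{1:t}):=\sup_{\sigma\in\mathcal S_{t+1}}\mathcal R_{\sigma;P(\cdot\mid x_{1:t})}(Y(x_{1:t},\cdot))$, and for $s<t$ the nested risk functional is $$\mathcal R_{\mathcal S_{s+1:t}}(Y\mid x_{1:s}):=\mathcal R_{\mathcal S_{s+1}}\bigl(\dots\mathcal R_{\mathcal S_{t-1}}\bigl(\mathcal R_{\mathcal S_t}(Y\mid x_{1:t-1})\mid x_{1:t-2}\bigr)\dots\mid x_{1:s}\bigr);$$ $\mathcal R_{\mathcal S_{T+1:T}}$ is the identity. Random variables are assumed to be such that the risk functionals are well defined. Policies: $\mathcal Z_{0:T}=\mathcal Z_0\times\dots\times\mathcal Z_T$ is the set of decisions. $z_{s:t}\lhd\mathcal F_{s:t}$ means that each $z_j\colon\Xi\to\mathcal Z_j$, $s\le j\le t$, is $\mathcal F_j$-measurable, i.e. $z_j=z_j(x_{1:j})$ (adapted policy). $Q\colon\mathcal Z_{0:T}\times\Xi_{1:T}\to\mathbb R\cup\{\infty\}$ is a lower semi-continuous cost function, written $Q(z;x)$. Value process associated with $z_{0:T}$: for $t=0,\dots,T$, $$v_t(z_{0:t-1}\mid x_{1:t}):=\inf_{z'_{t:T}\lhd\mathcal F_{t:T}}\mathcal R_{\mathcal S_{t+1:T}}\Bigl(Q\bigl(z_{0:t-1}(x_{1:t-1}),z'_{t:T}(x_{1:t},\cdot);x_{1:t},\cdot\bigr)\mid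 x_{1:t}\Bigr).$$ Convention: infima of families of random variables (functions of $x_{1:t}$ indexed by policies) are understood as essential infima. A stochastic process $(v_t)_{t=0}^T$ is an $\mathcal R$-submartingale if $v_t\le\mathcal R_{\mathcal S_{t+1}}(v_{t+1})$ a.s. for every $t$, where $\mathcal R_{\mathcal S_{t+1}}(v_{t+1})$ is the random variable $x_{1:t}\mapsto\mathcal R_{\mathcal S_{t+1}}(v_{t+1}\mid x_{1:t})$.
   Formalization: The well-definedness assumption is made explicit: the nested risks of all adapted policies are measurable, and the values v_t, t=1,…,T, along the given policy are assumed > −∞ almost surely; without the latter the inequality can fail. *)

theory Defs
  imports "HOL-Probability.Probability"
begin

(* The stages may carry different spaces: both the outcome spaces X 1, ..., X T and the decision
   spaces Z 0, ..., Z T are given as topologies on (arbitrary subsets of) one carrier type each. *)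

definition Polish_space :: "'a topology \<Rightarrow> bool" where
  "Polish_space X \<longleftrightarrow> completely_metrizable_space X \<and> separable_space X"

definition lower_semicontinuous_map :: "'a topology \<Rightarrow> ('a \<Rightarrow> ereal) \<Rightarrow> bool" where
  "lower_semicontinuous_map X f \<longleftrightarrow> (\<forall>c. openin X {x \<in> topspace X. c < f x})"

definition borel_of :: "'a topology \<Rightarrow> 'a measure" where
  "borel_of X = sigma (topspace X) {U. openin X U}"

(* A tuple (x_i), i in I, is an extensional function on I, so x_{1:t} is restrict x {1..t}
   and x_{1:0} is the only element of the product over the empty index set. *)

definition path_space :: "(nat \<Rightarrow> 'a topology) \<Rightarrow> nat set \<Rightarrow> (nat \<Rightarrow> 'a) measure" where
  "path_space X I = borel_of (product_topology X I)"

definition stage_algebra ::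
    "(nat \<Rightarrow> 'a topology) \<Rightarrow> nat \<Rightarrow> nat \<Rightarrow> (nat \<Rightarrow> 'a) measure" where
  "stage_algebra X T t =
     vimage_algebra (space (path_space X {1..T})) (\<lambda>x. restrict x {1..t}) (path_space X {1..t})"

definition regular_conditional_prob ::
    "(nat \<Rightarrow> 'a) measure \<Rightarrow> (nat \<Rightarrow> 'a topology) \<Rightarrow> nat \<Rightarrow> nat
      \<Rightarrow> ((nat \<Rightarrow> 'a) \<Rightarrow> (nat \<Rightarrow> 'a) measure) \<Rightarrow> bool" where
  "regular_conditional_prob P X T t \<kappa> \<longleftrightarrow>
     \<kappa> \<in> path_space X {1..t} \<rightarrow>\<^sub>M prob_algebra (path_space X {Suc t..T}) \<and>
     (\<forall>A \<in> sets (path_space X {1..t}). \<forall>B \<in> sets (path_space X {Suc t..T}).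
        emeasure P {x \<in> space P. restrict x {1..t} \<in> A \<and> restrict x {Suc t..T} \<in> B} =
        (\<integral>\<^sup>+ x. emeasure (\<kappa> (restrict x {1..t})) B * indicator A (restrict x {1..t}) \<partial>P))"

definition distortion_function :: "(real \<Rightarrow> real) \<Rightarrow> bool" where
  "distortion_function \<sigma> \<longleftrightarrow>
     mono_on {0..<1} \<sigma> \<and> (\<forall>u\<in>{0..<1}. 0 \<le> \<sigma> u) \<and> (LBINT u:{0..<1}. \<sigma> u) = 1"

(* If both parts are infinite, the difference is \<infinity> - \<infinity> = \<infinity> in ereal. *)

definition ext_expectation :: "'c measure \<Rightarrow> ('c \<Rightarrow> ereal) \<Rightarrow> ereal" where
  "ext_expectation M Y =
     enn2ereal (\<integral>\<^sup>+ \<omega>. e2ennreal (Y \<omega>) \<partial>M) - enn2ereal (\<integral>\<^sup>+ \<omega>. e2ennreal (- Y \<omega>) \<partial>M)"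

definition AVaR :: "real \<Rightarrow> 'c measure \<Rightarrow> ('c \<Rightarrow> ereal) \<Rightarrow> ereal" where
  "AVaR \<alpha> M Y =
     (INF c::real. ereal c + ereal (1 / (1 - \<alpha>)) * ext_expectation M (\<lambda>\<omega>. max 0 (Y \<omega> - ereal c)))"

definition risk_densities :: "(real \<Rightarrow> real) \<Rightarrow> 'c measure \<Rightarrow> ('c \<Rightarrow> real) set" where
  "risk_densities \<sigma> M =
     {\<zeta> \<in> borel_measurable M. (\<forall>\<omega>\<in>space M. 0 \<le> \<zeta> \<omega>) \<and>
        ext_expectation M (\<lambda>\<omega>. ereal (\<zeta> \<omega>)) = 1 \<and>
        (\<forall>\<alpha>\<in>{0<..<1}. AVaR \<alpha> M (\<lambda>\<omega>. ereal (\<zeta> \<omega>)) \<le>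
           ereal (1 / (1 - \<alpha>) * (LBINT u:{\<alpha>..<1}. \<sigma> u)))}"

definition risk_functional :: "(real \<Rightarrow> real) \<Rightarrow> 'c measure \<Rightarrow> ('c \<Rightarrow> ereal) \<Rightarrow> ereal" where
  "risk_functional \<sigma> M Y =
     (SUP \<zeta>\<in>risk_densities \<sigma> M. ext_expectation M (\<lambda>\<omega>. Y \<omega> * ereal (\<zeta> \<omega>)))"

(* cond_risk T K S t Y is R_{S_{t+1}}(Y | x_{1:t}), with K t (x_{1:t}) = P(. | x_{1:t}).
   All random variables, also those depending on x_{1:t} only, are functions of the whole path. *)

definition cond_risk ::
    "nat \<Rightarrow> (nat \<Rightarrow> (nat \<Rightarrow> 'a) \<Rightarrow> (nat \<Rightarrow> 'a) measure) \<Rightarrow> (nat \<Rightarrow> (real \<Rightarrow> real) set) \<Rightarrow> nat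
      \<Rightarrow> ((nat \<Rightarrow> 'a) \<Rightarrow> ereal) \<Rightarrow> (nat \<Rightarrow> 'a) \<Rightarrow> ereal" where
  "cond_risk T K S t Y x =
     (SUP \<sigma>\<in>S (Suc t). risk_functional \<sigma> (K t (restrict x {1..t}))
        (\<lambda>y. Y (merge {1..t} {Suc t..T} (x, y))))"

(* nested_risk T K S s t is R_{S_{s+1:t}}( . | x_{1:s}):
   cond_risk T K S s (cond_risk T K S (s+1) ( ... (cond_risk T K S (t-1) Y))),
   the identity if s = t. *)

definition nested_risk ::
    "nat \<Rightarrow> (nat \<Rightarrow> (nat \<Rightarrow> 'a) \<Rightarrow> (nat \<Rightarrow> 'a) measure) \<Rightarrow> (nat \<Rightarrow> (real \<Rightarrow> real) set) \<Rightarrow> nat \<Rightarrow> nat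
      \<Rightarrow> ((nat \<Rightarrow> 'a) \<Rightarrow> ereal) \<Rightarrow> (nat \<Rightarrow> 'a) \<Rightarrow> ereal" where
  "nested_risk T K S s t = foldr (cond_risk T K S) [s..<t]"

(* The decision of an adapted policy at stage j is a measurable function of x_{1:j}. *)

definition adapted_policy ::
    "(nat \<Rightarrow> 'a topology) \<Rightarrow> (nat \<Rightarrow> 'b topology) \<Rightarrow> nat set \<Rightarrow> (nat \<Rightarrow> (nat \<Rightarrow> 'a) \<Rightarrow> 'b) \<Rightarrow> bool"
  where "adapted_policy X Z J z \<longleftrightarrow> (\<forall>j\<in>J. z j \<in> path_space X {1..j} \<rightarrow>\<^sub>M borel_of (Z j))"

definition policy_cost ::
    "nat \<Rightarrow> ((nat \<Rightarrow> 'b) \<times> (nat \<Rightarrow> 'a) \<Rightarrow> ereal) \<Rightarrow> (nat \<Rightarrow> (nat \<Rightarrow> 'a) \<Rightarrow> 'b)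
      \<Rightarrow> (nat \<Rightarrow> 'a) \<Rightarrow> ereal" where
  "policy_cost T Q z x = Q (\<lambda>j\<in>{0..T}. z j (restrict x {1..j}), x)"

definition is_ess_inf ::
    "'c measure \<Rightarrow> 'c measure \<Rightarrow> ('c \<Rightarrow> ereal) set \<Rightarrow> ('c \<Rightarrow> ereal) \<Rightarrow> bool" where
  "is_ess_inf P F \<Y> g \<longleftrightarrow>
     g \<in> borel_measurable F \<and> (\<forall>Y\<in>\<Y>. AE \<omega> in P. g \<omega> \<le> Y \<omega>) \<and>
     (\<forall>h\<in>borel_measurable F. (\<forall>Y\<in>\<Y>. AE \<omega> in P. h \<omega> \<le> Y \<omega>) \<longrightarrow> (AE \<omega> in P. h \<omega> \<le> g \<omega>))"

(* Essential infima exist for families of F-measurable extended real functions on a probability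
   space and are unique up to null sets; the choice operator selects a version. *)

definition ess_inf :: "'c measure \<Rightarrow> 'c measure \<Rightarrow> ('c \<Rightarrow> ereal) set \<Rightarrow> 'c \<Rightarrow> ereal" where
  "ess_inf P F \<Y> = (SOME g. is_ess_inf P F \<Y> g)"

definition value_process ::
    "nat \<Rightarrow> (nat \<Rightarrow> 'a topology) \<Rightarrow> (nat \<Rightarrow> 'b topology) \<Rightarrow> (nat \<Rightarrow> 'a) measure
      \<Rightarrow> (nat \<Rightarrow> (nat \<Rightarrow> 'a) \<Rightarrow> (nat \<Rightarrow> 'a) measure) \<Rightarrow> (nat \<Rightarrow> (real \<Rightarrow> real) set)
      \<Rightarrow> ((nat \<Rightarrow> 'b) \<times> (nat \<Rightarrow> 'a) \<Rightarrow> ereal) \<Rightarrow> (nat \<Rightarrow> (nat \<Rightarrow> 'a) \<Rightarrow> 'b)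
      \<Rightarrow> nat \<Rightarrow> (nat \<Rightarrow> 'a) \<Rightarrow> ereal" where
  "value_process T X Z P K S Q z t =
     ess_inf P (stage_algebra X T t)
       {nested_risk T K S t T (policy_cost T Q (\<lambda>j. if j < t then z j else z' j)) | z'.
          adapted_policy X Z {t..T} z'}"

definition risk_submartingale ::
    "nat \<Rightarrow> (nat \<Rightarrow> 'a) measure \<Rightarrow> (nat \<Rightarrow> (nat \<Rightarrow> 'a) \<Rightarrow> (nat \<Rightarrow> 'a) measure)
      \<Rightarrow> (nat \<Rightarrow> (real \<Rightarrow> real) set) \<Rightarrow> (nat \<Rightarrow> (nat \<Rightarrow> 'a) \<Rightarrow> ereal) \<Rightarrow> bool" where
  "risk_submartingale T P K S v \<longleftrightarrow> (\<forall>t<T. AE x in P. v t x \<le> cond_risk T K S t (v (Suc t)) x)"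

end

theory Submission
  imports Defs
begin

text \<open>The value at time \<open>t + 1\<close> is an essential infimum of nested risks over the
continuations from \<open>t + 1\<close> on. Were it attained by a continuation, then following
\<open>z\<close> up to and including time \<open>t\<close> and this continuation afterwards would be a
policy competing in the value at time \<open>t\<close>, with nested risk at time \<open>t\<close> equal
to the one-step risk of the value at time \<open>t + 1\<close>. This is the asserted inequality.

The infimum need not be attained, and minimising sequences alone do not help: the risk functionals
are suprema of expectations, hence need not be continuous along decreasing sequences. Instead one
continuation is constructed that is within \<open>e\<close> of the value on almost every path
(\<open>ex_nearly_optimal_continuation\<close>). The essential infimum is the infimum of countably
many members of the family (\<open>ess_inf_attained_by_countable_subfamily\<close>); at each path the
first of these that is \<open>e\<close>-optimal is chosen. The choice depends on the information at
time \<open>t + 1\<close> only, so the pasted continuation is adapted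
(\<open>adapted_policy_paste\<close>), and the nested risk, being local
(\<open>nested_risk_cong\<close>), agrees on each path with that of the chosen member.

It remains to let the one-step risk act on an inequality that holds almost surely and up to
\<open>e\<close>. The exceptional null set is negligible for almost every conditional law
(\<open>AE_regular_conditional_prob\<close>), and \<open>e\<close> is passed on without amplification because
the densities have expectation one (\<open>risk_functional_le_add\<close>). Letting \<open>e\<close>
tend to zero finishes the argument.\<close>

section \<open>Borel sets of finite products of Polish spaces\<close>

text \<open>The balls of radius \<open>1 / (n + 1)\<close> around the points of a countable dense set form a base.\<close>

lemma separable_metrizable_imp_second_countable:
  assumes "metrizable_space X" "separable_space X"
  shows "second_countable X"
proof -
  obtain M d where "Metric_space M d" and Xeq: "X = Metric_space.mtopology M d"
    using assms(1) unfolding metrizable_space_def by blast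
  then interpret Metric_space M d by simp
  obtain D where D: "countable D" "D \<subseteq> topspace X" "X closure_of D = topspace X"
    using assms(2) unfolding separable_space_def by blast
  define B where "B = (\<lambda>(a, n::nat). mball a (1 / real (Suc n))) ` (D \<times> UNIV)"
  have "countable B" using D by (auto simp: B_def)
  moreover have "openin X V" if "V \<in> B" for V
    using that by (auto simp: B_def Xeq)
  moreover have "\<exists>V\<in>B. x \<in> V \<and> V \<subseteq> U" if U: "openin X U" "x \<in> U" for U x
  proof -
    obtain r where r: "r > 0" "mball x r \<subseteq> U" and xM: "x \<in> M"
      using U unfolding Xeq openin_mtopology by blast
    obtain n :: nat where n: "1 / real (Suc n) < r / 2"
      using r(1) by (meson half_gt_zero nat_approx_posE)
    have "x \<in> X closure_of D" using D(3) xM Xeq by simp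
    moreover have "openin X (mball x (1 / real (Suc n)))" "x \<in> mball x (1 / real (Suc n))"
      using xM by (auto simp: Xeq)
    ultimately obtain a where a: "a \<in> D" "a \<in> mball x (1 / real (Suc n))"
      unfolding in_closure_of by blast
    have "mball a (1 / real (Suc n)) \<subseteq> mball x r"
    proof
      fix y assume "y \<in> mball a (1 / real (Suc n))"
      then show "y \<in> mball x r"
        using a(2) n triangle[of x a y] by auto
    qed
    moreover have "x \<in> mball a (1 / real (Suc n))"
      using a(2) commute by auto
    moreover have "mball a (1 / real (Suc n)) \<in> B"
      using a(1) unfolding B_def by (intro image_eqI[of _ _ "(a, n)"]) auto
    ultimately show ?thesis using r(2) by (meson order_trans)
  qed
  ultimately show ?thesis unfolding second_countable_def by blast
qed

lemma Polish_imp_second_countable: "Polish_space X \<Longrightarrow> second_countable X"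
  by (simp add: Polish_space_def completely_metrizable_imp_metrizable_space
      separable_metrizable_imp_second_countable)

lemma space_borel_of [simp]: "space (borel_of X) = topspace X"
  unfolding borel_of_def by (rule space_measure_of) (auto dest: openin_subset)

lemma sets_borel_of: "sets (borel_of X) = sigma_sets (topspace X) {U. openin X U}"
  unfolding borel_of_def by (rule sets_measure_of) (auto dest: openin_subset)

lemma openin_imp_sets_borel_of: "openin X U \<Longrightarrow> U \<in> sets (borel_of X)"
  by (auto simp: sets_borel_of)

lemma measurable_borel_of_continuous_map:
  assumes "continuous_map X Y f"
  shows "f \<in> borel_of X \<rightarrow>\<^sub>M borel_of Y"
  unfolding borel_of_def[of Y]
proof (rule measurable_measure_of)
  show "f \<in> space (borel_of X) \<rightarrow> topspace Y"
    using assms by (auto simp: continuous_map_def)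
next
  fix U assume "U \<in> {U. openin Y U}"
  then have "openin X {x \<in> topspace X. f x \<in> U}"
    using assms by (auto simp: continuous_map_def)
  moreover have "f -` U \<inter> space (borel_of X) = {x \<in> topspace X. f x \<in> U}"
    by auto
  ultimately show "f -` U \<inter> space (borel_of X) \<in> sets (borel_of X)"
    by (simp add: openin_imp_sets_borel_of)
qed (auto dest: openin_subset)

text \<open>For second countable factors an open set is a \<^emph>\<open>countable\<close> union of open boxes,
hence belongs to the product sigma algebra; without a countable base the Borel sigma algebra of the
product may be strictly larger. This is what makes concatenation of path segments measurable, and
what allows a law on paths to be recognised from its values on rectangles.\<close>

lemma sets_borel_of_product_topology:
  assumes "finite I" and sc: "\<And>i. i \<in> I \<Longrightarrow> second_countable (X i)"
  shows "sets (borel_of (product_topology X I)) = sets (\<Pi>\<^sub>M i\<in>I. borel_of (X i))"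
proof
  obtain B where B: "\<And>i. i \<in> I \<Longrightarrow> countable (B i)" "\<And>i V. i \<in> I \<Longrightarrow> V \<in> B i \<Longrightarrow> openin (X i) V"
    "\<And>i U x. i \<in> I \<Longrightarrow> openin (X i) U \<Longrightarrow> x \<in> U \<Longrightarrow> \<exists>V\<in>B i. x \<in> V \<and> V \<subseteq> U"
    using sc unfolding second_countable_def by metis
  have "W \<in> sets (\<Pi>\<^sub>M i\<in>I. borel_of (X i))" if W: "openin (product_topology X I) W" for W
  proof -
    define \<U> where "\<U> = {V \<in> PiE I B. PiE I V \<subseteq> W}"
    have "countable \<U>"
      using countable_PiE[of I B] \<open>finite I\<close> B(1) by (simp add: \<U>_def)
    moreover have "PiE I V \<in> sets (\<Pi>\<^sub>M i\<in>I. borel_of (X i))" if "V \<in> \<U>" for V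
      using that B(2) \<open>finite I\<close>
      by (intro sets_PiM_I_finite) (auto simp: \<U>_def PiE_mem intro!: openin_imp_sets_borel_of)
    moreover have "W = (\<Union>V\<in>\<U>. PiE I V)"
    proof
      show "W \<subseteq> (\<Union>V\<in>\<U>. PiE I V)"
      proof
        fix x assume "x \<in> W"
        then have "\<exists>U. (\<forall>i\<in>I. openin (X i) (U i)) \<and> x \<in> PiE I U \<and> PiE I U \<subseteq> W"
          using W
          by (simp only: openin_product_topology_alt)
             (drule bspec, assumption, elim exE conjE, rule exI, intro conjI)
        then obtain U where U: "\<And>i. i \<in> I \<Longrightarrow> openin (X i) (U i)" "x \<in> PiE I U" "PiE I U \<subseteq> W"
          by blast
        have "\<forall>i\<in>I. \<exists>V\<in>B i. x i \<in> V \<and> V \<subseteq> U i"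
          using B(3) U(1,2) by (meson PiE_mem)
        then obtain V where V: "\<And>i. i \<in> I \<Longrightarrow> V i \<in> B i \<and> x i \<in> V i \<and> V i \<subseteq> U i"
          by metis
        have "PiE I (restrict V I) \<subseteq> PiE I U"
          using V by (intro PiE_mono) auto
        then have "restrict V I \<in> \<U>"
          using V U(3) by (auto simp: \<U>_def)
        moreover have "x \<in> PiE I (restrict V I)"
          using V U(2) by (auto simp: PiE_iff)
        ultimately show "x \<in> (\<Union>V\<in>\<U>. PiE I V)" by blast
      qed
    qed (auto simp: \<U>_def)
    ultimately show ?thesis by (metis (lifting) sets.countable_UN'')
  qed
  then show "sets (borel_of (product_topology X I)) \<subseteq> sets (\<Pi>\<^sub>M i\<in>I. borel_of (X i))"
    unfolding sets_borel_of
    using sets.sigma_sets_subset[of "{U. openin (product_topology X I) U}" "\<Pi>\<^sub>M i\<in>I. borel_of (X i)"]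
    by (auto simp: space_PiM)
  have id: "(\<lambda>x. x) \<in> borel_of (product_topology X I) \<rightarrow>\<^sub>M (\<Pi>\<^sub>M i\<in>I. borel_of (X i))"
  proof (rule measurable_PiM_single')
    show "(\<lambda>x. x i) \<in> borel_of (product_topology X I) \<rightarrow>\<^sub>M borel_of (X i)" if "i \<in> I" for i
      using that by (intro measurable_borel_of_continuous_map continuous_map_product_projection)
  qed auto
  show "sets (\<Pi>\<^sub>M i\<in>I. borel_of (X i)) \<subseteq> sets (borel_of (product_topology X I))"
  proof
    fix A assume A: "A \<in> sets (\<Pi>\<^sub>M i\<in>I. borel_of (X i))"
    then have "A \<subseteq> topspace (product_topology X I)"
      using sets.sets_into_space[OF A] by (simp add: space_PiM)
    then show "A \<in> sets (borel_of (product_topology X I))"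
      using measurable_sets[OF id A] by (simp add: Int_absorb2)
  qed
qed

section \<open>Essential infima\<close>

text \<open>Any bounded, strictly increasing, measurable transformation of the extended reals would do: it
makes all expectations finite and, being injective, loses no information.\<close>

definition ereal_arctan :: "ereal \<Rightarrow> real" where
  "ereal_arctan y = (if y = \<infinity> then 2 else if y = -\<infinity> then -2 else arctan (real_of_ereal y))"

lemma measurable_ereal_arctan [measurable]: "ereal_arctan \<in> borel_measurable borel"
  unfolding ereal_arctan_def[abs_def] by measurable

lemma abs_ereal_arctan_le: "\<bar>ereal_arctan y\<bar> \<le> 2"
proof -
  have "\<bar>arctan r\<bar> < 2" for r
    using arctan_bounded[of r] pi_half_less_two by linarith
  then show ?thesis by (simp add: ereal_arctan_def less_imp_le)
qed

lemma strict_mono_ereal_arctan: "strict_mono ereal_arctan"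
proof (rule strict_monoI)
  have b: "- 2 < arctan r \<and> arctan r < 2" for r
    using arctan_bounded[of r] pi_half_less_two by linarith
  fix x y :: ereal assume "x < y"
  then show "ereal_arctan x < ereal_arctan y"
    by (cases x; cases y) (auto simp: ereal_arctan_def b arctan_monotone)
qed

text \<open>Exhaustion: among all countable subfamilies, one minimises the expected transformed infimum, since
the union of a minimising sequence of countable subfamilies is again countable. Adding a further
member \<open>Y\<close> to the minimiser cannot decrease the expectation, so its infimum was already
below \<open>Y\<close> almost surely.\<close>

lemma (in prob_space) ess_inf_attained_by_countable_subfamily:
  fixes \<Y> :: "('a \<Rightarrow> ereal) set"
  assumes F: "\<And>h::'a \<Rightarrow> ereal. h \<in> borel_measurable F \<Longrightarrow> h \<in> borel_measurable M"
    and \<Y>: "\<Y> \<subseteq> borel_measurable F" "\<Y> \<noteq> {}"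
  obtains f where "\<And>n::nat. f n \<in> \<Y>" "is_ess_inf M F \<Y> (\<lambda>\<omega>. INF n. f n \<omega>)"
proof -
  define J where "J f = (\<integral>\<omega>. ereal_arctan (INF n::nat. f n \<omega>) \<partial>M)" for f
  define m where "m = (INF f\<in>UNIV \<rightarrow> \<Y>. J f)"
  have meas: "(\<lambda>\<omega>. INF n. f n \<omega>) \<in> borel_measurable M" if "f \<in> UNIV \<rightarrow> \<Y>" for f :: "nat \<Rightarrow> 'a \<Rightarrow> ereal"
  proof -
    have "f n \<in> borel_measurable M" for n using that \<Y>(1) F by blast
    then show ?thesis by simp
  qed
  have int: "integrable M (\<lambda>\<omega>. ereal_arctan (INF n. f n \<omega>))" if "f \<in> UNIV \<rightarrow> \<Y>"
    for f :: "nat \<Rightarrow> 'a \<Rightarrow> ereal"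
    using meas[OF that] abs_ereal_arctan_le
    by (intro integrable_const_bound[where B = 2]) auto
  have mono: "J f \<le> J g" if "f \<in> UNIV \<rightarrow> \<Y>" "g \<in> UNIV \<rightarrow> \<Y>" "\<And>\<omega>. (INF n. f n \<omega>) \<le> (INF n. g n \<omega>)" for f g
    unfolding J_def
    by (intro integral_mono int that strict_mono_ereal_arctan[THEN strict_mono_less_eq, THEN iffD2])
  have bdd: "bdd_below (J ` (UNIV \<rightarrow> \<Y>))"
  proof (rule bdd_belowI2)
    fix f :: "nat \<Rightarrow> 'a \<Rightarrow> ereal" assume f: "f \<in> UNIV \<rightarrow> \<Y>"
    have "(\<integral>\<omega>. -2 \<partial>M) \<le> J f"
      unfolding J_def
    proof (rule integral_mono[OF _ int[OF f]])
      show "-2 \<le> ereal_arctan (INF n. f n \<omega>)" for \<omega>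
        using abs_ereal_arctan_le[of "INF n. f n \<omega>"] by linarith
    qed simp
    then show "-2 \<le> J f" by (simp add: prob_space)
  qed
  have "UNIV \<rightarrow> \<Y> \<noteq> {}" using \<Y>(2) by auto
  then have "\<exists>f\<in>UNIV \<rightarrow> \<Y>. J f < m + 1 / real (Suc k)" for k
    using cINF_less_iff[OF _ bdd, of "m + 1 / real (Suc k)"] unfolding m_def by auto
  then obtain f where f: "\<And>k. f k \<in> UNIV \<rightarrow> \<Y>" "\<And>k. J (f k) < m + 1 / real (Suc k)"
    by metis
  \<comment> \<open>One sequence running through all the members of the minimising sequences.\<close>
  define g where "g n = f (fst (prod_decode n)) (snd (prod_decode n))" for n
  have g: "g \<in> UNIV \<rightarrow> \<Y>" using f(1)[THEN funcset_mem] by (simp add: g_def)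
  have J_le: "J g \<le> m + 1 / real (Suc k)" for k
  proof -
    have "J g \<le> J (f k)"
    proof (rule mono[OF g f(1)], rule INF_mono)
      fix \<omega> n
      show "\<exists>l\<in>UNIV. g l \<omega> \<le> f k n \<omega>"
        by (intro bexI[of _ "prod_encode (k, n)"]) (auto simp: g_def)
    qed
    then show ?thesis using f(2)[of k] by simp
  qed
  have "J g \<le> m"
  proof (rule field_le_epsilon)
    fix e :: real assume "0 < e"
    then obtain k :: nat where "1 / real (Suc k) < e" by (rule nat_approx_posE)
    then show "J g \<le> m + e" using J_le[of k] by linarith
  qed
  have "AE \<omega> in M. (INF n. g n \<omega>) \<le> Y \<omega>" if "Y \<in> \<Y>" for Y
  proof -
    define g' where "g' = case_nat Y g"
    have g': "g' \<in> UNIV \<rightarrow> \<Y>" using funcset_mem[OF g] that by (simp add: g'_def split: nat.splits)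
    have le: "(INF n. g' n \<omega>) \<le> (INF n. g n \<omega>)" for \<omega>
      by (rule INF_mono) (metis UNIV_I g'_def nat.case(2) order_refl)
    have "m \<le> J g'" unfolding m_def using g' by (intro cINF_lower bdd)
    with \<open>J g \<le> m\<close> mono[OF g' g le] have "J g = J g'" by simp
    then have "(\<integral>\<omega>. ereal_arctan (INF n. g n \<omega>) - ereal_arctan (INF n. g' n \<omega>) \<partial>M) = 0"
      using int[OF g] int[OF g'] by (simp add: J_def)
    then have "AE \<omega> in M. ereal_arctan (INF n. g n \<omega>) - ereal_arctan (INF n. g' n \<omega>) = 0"
      using int[OF g] int[OF g'] strict_mono_ereal_arctan[THEN strict_mono_less_eq, THEN iffD2, OF le]
      by (subst (asm) integral_nonneg_eq_0_iff_AE) simp_all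
    then show ?thesis
    proof eventually_elim
      case (elim \<omega>)
      then have "(INF n. g n \<omega>) = (INF n. g' n \<omega>)"
        using strict_mono_eq[OF strict_mono_ereal_arctan] by simp
      also have "\<dots> \<le> g' 0 \<omega>" by (intro INF_lower) simp
      finally show ?case by (simp add: g'_def)
    qed
  qed
  moreover have "AE \<omega> in M. h \<omega> \<le> (INF n. g n \<omega>)" if "\<forall>Y\<in>\<Y>. AE \<omega> in M. h \<omega> \<le> Y \<omega>" for h
  proof -
    have "AE \<omega> in M. \<forall>n. h \<omega> \<le> g n \<omega>"
      using that g by (auto simp: AE_all_countable)
    then show ?thesis by eventually_elim (simp add: le_INF_iff)
  qed
  moreover have "(\<lambda>\<omega>. INF n. g n \<omega>) \<in> borel_measurable F"
  proof -
    have "g n \<in> borel_measurable F" for n using g \<Y>(1) by blast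
    then show ?thesis by simp
  qed
  ultimately have "is_ess_inf M F \<Y> (\<lambda>\<omega>. INF n. g n \<omega>)"
    by (simp add: is_ess_inf_def)
  then show ?thesis using that g by blast
qed

section \<open>Monotonicity and translation of risk functionals\<close>

lemma ext_expectation_mono_AE:
  assumes "AE \<omega> in M. Y \<omega> \<le> Y' \<omega>"
  shows "ext_expectation M Y \<le> ext_expectation M Y'"
  unfolding ext_expectation_def
proof (intro ereal_minus_mono)
  show "enn2ereal (\<integral>\<^sup>+ \<omega>. e2ennreal (Y \<omega>) \<partial>M) \<le> enn2ereal (\<integral>\<^sup>+ \<omega>. e2ennreal (Y' \<omega>) \<partial>M)"
    using assms unfolding less_eq_ennreal.rep_eq[symmetric]
    by (intro nn_integral_mono_AE) (auto elim!: eventually_mono intro: e2ennreal_mono)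
  show "enn2ereal (\<integral>\<^sup>+ \<omega>. e2ennreal (- Y' \<omega>) \<partial>M) \<le> enn2ereal (\<integral>\<^sup>+ \<omega>. e2ennreal (- Y \<omega>) \<partial>M)"
    using assms unfolding less_eq_ennreal.rep_eq[symmetric]
    by (intro nn_integral_mono_AE) (auto elim!: eventually_mono intro: e2ennreal_mono)
qed

lemma e2ennreal_add_real_le:
  "0 \<le> v \<Longrightarrow> e2ennreal (w + ereal v) \<le> e2ennreal w + ennreal v"
proof (cases w)
  case (real r)
  assume "0 \<le> v"
  then show ?thesis
    by (cases "0 \<le> r") (auto simp: real ennreal_plus[symmetric] ennreal_neg simp del: ennreal_plus intro!: ennreal_leI)
qed auto

text \<open>Positive and negative parts satisfy
\<open>(W + V)\<^sup>+ + W\<^sup>- = W\<^sup>+ + V + (W + V)\<^sup>-\<close>, which is integrated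
and rearranged. Only an inequality is stated, and it survives infinite integrals: under the convention
\<open>\<infinity> - \<infinity> = \<infinity>\<close> the right-hand side is infinite as soon as the
positive part of \<open>W\<close> is not integrable.\<close>

lemma ext_expectation_add_le:
  assumes W [measurable]: "W \<in> borel_measurable M" and V [measurable]: "V \<in> borel_measurable M"
    and V0: "\<And>\<omega>. \<omega> \<in> space M \<Longrightarrow> 0 \<le> V \<omega>"
    and int_V: "(\<integral>\<^sup>+ \<omega>. ennreal (V \<omega>) \<partial>M) = ennreal e" and "0 \<le> e"
  shows "ext_expectation M (\<lambda>\<omega>. W \<omega> + ereal (V \<omega>)) \<le> ext_expectation M W + ereal e"
proof -
  define a b a' b' where "a = (\<integral>\<^sup>+ \<omega>. e2ennreal (W \<omega>) \<partial>M)" and "b = (\<integral>\<^sup>+ \<omega>. e2ennreal (- W \<omega>) \<partial>M)"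
    and "a' = (\<integral>\<^sup>+ \<omega>. e2ennreal (W \<omega> + ereal (V \<omega>)) \<partial>M)"
    and "b' = (\<integral>\<^sup>+ \<omega>. e2ennreal (- (W \<omega> + ereal (V \<omega>))) \<partial>M)"
  have "a' \<le> (\<integral>\<^sup>+ \<omega>. e2ennreal (W \<omega>) + ennreal (V \<omega>) \<partial>M)"
    unfolding a'_def using V0 by (intro nn_integral_mono e2ennreal_add_real_le)
  also have "\<dots> = a + ennreal e"
    by (subst nn_integral_add) (simp_all add: a_def int_V)
  finally have a': "a' \<le> a + ennreal e" .
  have "b \<le> (\<integral>\<^sup>+ \<omega>. e2ennreal (- (W \<omega> + ereal (V \<omega>))) + ennreal (V \<omega>) \<partial>M)"
    unfolding b_def
  proof (rule nn_integral_mono)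
    fix \<omega> assume "\<omega> \<in> space M"
    have "- W \<omega> = - (W \<omega> + ereal (V \<omega>)) + ereal (V \<omega>)"
      by (cases "W \<omega>") auto
    then show "e2ennreal (- W \<omega>) \<le> e2ennreal (- (W \<omega> + ereal (V \<omega>))) + ennreal (V \<omega>)"
      using e2ennreal_add_real_le[OF V0[OF \<open>\<omega> \<in> space M\<close>], of "- (W \<omega> + ereal (V \<omega>))"] by simp
  qed
  also have "\<dots> = b' + ennreal e"
    by (subst nn_integral_add) (simp_all add: b'_def int_V)
  finally have b: "b \<le> b' + ennreal e" .
  have "a' + b = (\<integral>\<^sup>+ \<omega>. e2ennreal (W \<omega> + ereal (V \<omega>)) + e2ennreal (- W \<omega>) \<partial>M)"
    by (subst nn_integral_add) (simp_all add: a'_def b_def)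
  also have "\<dots> = (\<integral>\<^sup>+ \<omega>. e2ennreal (W \<omega>) + ennreal (V \<omega>) + e2ennreal (- (W \<omega> + ereal (V \<omega>))) \<partial>M)"
  proof (rule nn_integral_cong)
    fix \<omega> assume "\<omega> \<in> space M"
    then have "0 \<le> V \<omega>" by (rule V0)
    then show "e2ennreal (W \<omega> + ereal (V \<omega>)) + e2ennreal (- W \<omega>) =
      e2ennreal (W \<omega>) + ennreal (V \<omega>) + e2ennreal (- (W \<omega> + ereal (V \<omega>)))"
    proof (cases "W \<omega>")
      case (real r)
      then show ?thesis using \<open>0 \<le> V \<omega>\<close>
        by (cases "0 \<le> r"; cases "0 \<le> r + V \<omega>")
           (auto simp: ennreal_plus[symmetric] ennreal_neg simp del: ennreal_plus)
    qed auto
  qed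
  also have "\<dots> = a + ennreal e + b'"
    by (subst nn_integral_add, simp, simp, subst nn_integral_add) (simp_all add: a_def b'_def int_V)
  finally have sum: "a' + b = a + ennreal e + b'" .
  have "enn2ereal a' - enn2ereal b' \<le> (enn2ereal a - enn2ereal b) + ereal e"
  proof (cases "a = \<infinity>")
    case True
    then show ?thesis by simp
  next
    case False
    then obtain ra where ra: "a = ennreal ra" "0 \<le> ra" by (cases a) auto
    with a' \<open>0 \<le> e\<close> have "a' \<noteq> \<infinity>"
      by (auto simp: top_unique ennreal_plus[symmetric] simp del: ennreal_plus)
    then obtain ra' where ra': "a' = ennreal ra'" "0 \<le> ra'" by (cases a') auto
    show ?thesis
    proof (cases "b' = \<infinity>")
      case True
      then show ?thesis using ra' by simp
    next
      case False
      then obtain rb' where rb': "b' = ennreal rb'" "0 \<le> rb'" by (cases b') auto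
      with b \<open>0 \<le> e\<close> have "b \<noteq> \<infinity>"
        by (auto simp: top_unique ennreal_plus[symmetric] simp del: ennreal_plus)
      then obtain rb where rb: "b = ennreal rb" "0 \<le> rb" by (cases b) auto
      have "ra' + rb = ra + e + rb'"
        using sum \<open>0 \<le> e\<close> ra ra' rb rb' by (simp add: ennreal_plus[symmetric] del: ennreal_plus)
      then show ?thesis using ra ra' rb rb' by simp
    qed
  qed
  then show ?thesis by (simp add: ext_expectation_def a_def b_def a'_def b'_def)
qed

lemma nn_integral_risk_density:
  assumes "\<zeta> \<in> risk_densities \<sigma> M"
  shows "(\<integral>\<^sup>+ \<omega>. ennreal (\<zeta> \<omega>) \<partial>M) = 1"
proof -
  have "(\<integral>\<^sup>+ \<omega>. e2ennreal (- ereal (\<zeta> \<omega>)) \<partial>M) = (\<integral>\<^sup>+ \<omega>. 0 \<partial>M)"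
    using assms by (intro nn_integral_cong) (auto simp: risk_densities_def ennreal_neg)
  then have "enn2ereal (\<integral>\<^sup>+ \<omega>. ennreal (\<zeta> \<omega>) \<partial>M) = 1"
    using assms by (simp add: risk_densities_def ext_expectation_def zero_ennreal.rep_eq)
  then show ?thesis by (metis enn2ereal_inject one_ennreal.rep_eq)
qed

text \<open>Monotonicity and translation in one statement. Densities are nonnegative, so each expectation in
the supremum is monotone, and they integrate to one, so a constant \<open>e\<close> adds at most
\<open>e\<close> to each of them.\<close>

lemma risk_functional_le_add:
  assumes le: "AE \<omega> in M. Y \<omega> \<le> Y' \<omega> + ereal e"
    and Y' [measurable]: "Y' \<in> borel_measurable M" and "0 \<le> e"
  shows "risk_functional \<sigma> M Y \<le> risk_functional \<sigma> M Y' + ereal e"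
  unfolding risk_functional_def
proof (rule SUP_least)
  fix \<zeta> assume \<zeta>: "\<zeta> \<in> risk_densities \<sigma> M"
  then have [measurable]: "\<zeta> \<in> borel_measurable M" and pos: "\<And>\<omega>. \<omega> \<in> space M \<Longrightarrow> 0 \<le> \<zeta> \<omega>"
    by (auto simp: risk_densities_def)
  have "AE \<omega> in M. Y \<omega> * ereal (\<zeta> \<omega>) \<le> Y' \<omega> * ereal (\<zeta> \<omega>) + ereal (e * \<zeta> \<omega>)"
    using le AE_space
  proof eventually_elim
    case (elim \<omega>)
    then have "Y \<omega> * ereal (\<zeta> \<omega>) \<le> (Y' \<omega> + ereal e) * ereal (\<zeta> \<omega>)"
      using pos by (intro ereal_mult_right_mono) auto
    also have "\<dots> = Y' \<omega> * ereal (\<zeta> \<omega>) + ereal (e * \<zeta> \<omega>)"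
      by (cases "Y' \<omega>") (auto simp: algebra_simps)
    finally show ?case .
  qed
  then have "ext_expectation M (\<lambda>\<omega>. Y \<omega> * ereal (\<zeta> \<omega>)) \<le>
      ext_expectation M (\<lambda>\<omega>. Y' \<omega> * ereal (\<zeta> \<omega>) + ereal (e * \<zeta> \<omega>))"
    by (rule ext_expectation_mono_AE)
  also have "\<dots> \<le> ext_expectation M (\<lambda>\<omega>. Y' \<omega> * ereal (\<zeta> \<omega>)) + ereal e"
  proof (rule ext_expectation_add_le)
    have "(\<integral>\<^sup>+ \<omega>. ennreal (e * \<zeta> \<omega>) \<partial>M) = (\<integral>\<^sup>+ \<omega>. ennreal e * ennreal (\<zeta> \<omega>) \<partial>M)"
      using pos \<open>0 \<le> e\<close> by (intro nn_integral_cong ennreal_mult) auto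
    then show "(\<integral>\<^sup>+ \<omega>. ennreal (e * \<zeta> \<omega>) \<partial>M) = ennreal e"
      by (simp add: nn_integral_cmult nn_integral_risk_density[OF \<zeta>])
  qed (use pos \<open>0 \<le> e\<close> in auto)
  also have "\<dots> \<le> (SUP \<zeta>\<in>risk_densities \<sigma> M. ext_expectation M (\<lambda>\<omega>. Y' \<omega> * ereal (\<zeta> \<omega>))) + ereal e"
    using \<zeta> by (intro add_right_mono SUP_upper)
  finally show "ext_expectation M (\<lambda>\<omega>. Y \<omega> * ereal (\<zeta> \<omega>)) \<le> \<dots>" .
qed

section \<open>Conditional and nested risk\<close>

lemma cond_risk_le_add:
  assumes le: "AE y in K t (restrict x {1..t}). Y (merge {1..t} {Suc t..T} (x, y))
        \<le> Y' (merge {1..t} {Suc t..T} (x, y)) + ereal e"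
    and "(\<lambda>y. Y' (merge {1..t} {Suc t..T} (x, y))) \<in> borel_measurable (K t (restrict x {1..t}))"
    and "0 \<le> e"
  shows "cond_risk T K S t Y x \<le> cond_risk T K S t Y' x + ereal e"
  unfolding cond_risk_def
proof (rule SUP_least)
  fix \<sigma> assume "\<sigma> \<in> S (Suc t)"
  then show "risk_functional \<sigma> (K t (restrict x {1..t})) (\<lambda>y. Y (merge {1..t} {Suc t..T} (x, y)))
    \<le> (SUP \<sigma>\<in>S (Suc t). risk_functional \<sigma> (K t (restrict x {1..t}))
          (\<lambda>y. Y' (merge {1..t} {Suc t..T} (x, y)))) + ereal e"
    by (intro order_trans[OF risk_functional_le_add[OF assms]] add_right_mono SUP_upper)
qed

lemma cond_risk_cong:
  assumes "\<And>x'. restrict x' {1..t} = restrict x {1..t} \<Longrightarrow> Y x' = Y' x'"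
  shows "cond_risk T K S t Y x = cond_risk T K S t Y' x"
proof -
  have "Y (merge {1..t} {Suc t..T} (x, y)) = Y' (merge {1..t} {Suc t..T} (x, y))" for y
    by (rule assms) (rule restrict_merge, auto)
  then show ?thesis by (simp add: cond_risk_def)
qed

lemma nested_risk_Suc: "s < t \<Longrightarrow> nested_risk T K S s t Y = cond_risk T K S s (nested_risk T K S (Suc s) t Y)"
  by (simp add: nested_risk_def upt_conv_Cons)

lemma nested_risk_self [simp]: "nested_risk T K S t t Y = Y"
  by (simp add: nested_risk_def)

text \<open>Locality: the conditional risk at a path only looks at the continuations of its first coordinates.
Hence risks of pasted policies can be computed piece by piece.\<close>

lemma nested_risk_cong:
  assumes "s \<le> t" and Y: "\<And>x'. restrict x' {1..s} = restrict x {1..s} \<Longrightarrow> Y x' = Y' x'"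
  shows "nested_risk T K S s t Y x = nested_risk T K S s t Y' x"
  using assms
proof (induction s arbitrary: x rule: inc_induct)
  case base
  then show ?case by simp
next
  case (step s)
  show ?case
    unfolding nested_risk_Suc[OF step.hyps(2)]
  proof (rule cond_risk_cong, rule step.IH)
    fix x' x'' :: "nat \<Rightarrow> 'a"
    assume x: "restrict x' {1..s} = restrict x {1..s}" "restrict x'' {1..Suc s} = restrict x' {1..Suc s}"
    have "restrict x'' {1..s} = restrict (restrict x'' {1..Suc s}) {1..s}"
      by (simp add: restrict_restrict Int_absorb1)
    also have "\<dots> = restrict x' {1..s}"
      unfolding x(2) by (simp add: restrict_restrict Int_absorb1)
    also note x(1)
    finally show "Y x'' = Y' x''" by (rule step.prems)
  qed
qed

section \<open>Path spaces and disintegration\<close>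

text \<open>The defining identity of a conditional distribution, given on rectangles, extends to the whole
product sigma algebra because rectangles form an intersection-stable generator.\<close>

lemma distr_split_eq_bind:
  assumes P: "prob_space P"
    and f: "f \<in> P \<rightarrow>\<^sub>M A" and g: "g \<in> P \<rightarrow>\<^sub>M B" and \<kappa>: "\<kappa> \<in> A \<rightarrow>\<^sub>M prob_algebra B"
    and eq: "\<And>a b. a \<in> sets A \<Longrightarrow> b \<in> sets B \<Longrightarrow>
      emeasure P {x \<in> space P. f x \<in> a \<and> g x \<in> b} = (\<integral>\<^sup>+ x. emeasure (\<kappa> (f x)) b * indicator a (f x) \<partial>P)"
  shows "distr P (A \<Otimes>\<^sub>M B) (\<lambda>x. (f x, g x)) =
    distr P A f \<bind> (\<lambda>u. distr (\<kappa> u) (A \<Otimes>\<^sub>M B) (\<lambda>y. (u, y)))" (is "?L = ?R")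
proof -
  interpret prob_space P by fact
  note [measurable] = f g \<kappa>
  have k: "(\<lambda>u. distr (\<kappa> u) (A \<Otimes>\<^sub>M B) (\<lambda>y. (u, y))) \<in> A \<rightarrow>\<^sub>M prob_algebra (A \<Otimes>\<^sub>M B)"
    by measurable
  have ne: "space (distr P A f) \<noteq> {}"
    using f not_empty by (auto simp: measurable_def)
  have sets_\<kappa>: "sets (\<kappa> u) = sets B" if "u \<in> space A" for u
    using measurable_space[OF \<kappa> that] by (simp add: space_prob_algebra)
  show ?thesis
  proof (rule measure_eqI_generator_eq[where E = "{a \<times> b | a b. a \<in> sets A \<and> b \<in> sets B}"
        and \<Omega> = "space A \<times> space B" and A = "\<lambda>_. space A \<times> space B"])
    show "Int_stable {a \<times> b |a b. a \<in> sets A \<and> b \<in> sets B}" by (rule Int_stable_pair_measure_generator)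
    show "sets ?L = sigma_sets (space A \<times> space B) {a \<times> b |a b. a \<in> sets A \<and> b \<in> sets B}"
      by (simp add: sets_pair_measure)
    show "sets ?R = sigma_sets (space A \<times> space B) {a \<times> b |a b. a \<in> sets A \<and> b \<in> sets B}"
      unfolding sets_pair_measure[symmetric]
      using ne by (intro sets_bind) auto
    show "emeasure ?L (space A \<times> space B) \<noteq> \<infinity>" for i :: nat
      by (simp add: emeasure_distr)
    fix W assume "W \<in> {a \<times> b |a b. a \<in> sets A \<and> b \<in> sets B}"
    then obtain a b where W: "W = a \<times> b" and [measurable]: "a \<in> sets A" "b \<in> sets B" by auto
    have "emeasure ?L W = emeasure P {x \<in> space P. f x \<in> a \<and> g x \<in> b}"
      by (subst emeasure_distr) (auto simp: W intro!: arg_cong[where f = "emeasure P"])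
    also have "\<dots> = (\<integral>\<^sup>+ x. emeasure (\<kappa> (f x)) b * indicator a (f x) \<partial>P)"
      by (rule eq) fact+
    also have "\<dots> = (\<integral>\<^sup>+ x. emeasure (distr (\<kappa> (f x)) (A \<Otimes>\<^sub>M B) (\<lambda>y. (f x, y))) W \<partial>P)"
    proof (rule nn_integral_cong)
      fix x assume "x \<in> space P"
      then have u: "f x \<in> space A" using f by (auto simp: measurable_def)
      then have [measurable_cong]: "sets (\<kappa> (f x)) = sets B" by (rule sets_\<kappa>)
      have "emeasure (distr (\<kappa> (f x)) (A \<Otimes>\<^sub>M B) (\<lambda>y. (f x, y))) W =
          emeasure (\<kappa> (f x)) ((\<lambda>y. (f x, y)) -` W \<inter> space (\<kappa> (f x)))"
        using u by (intro emeasure_distr) (auto simp: W)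
      also have "(\<lambda>y. (f x, y)) -` W \<inter> space (\<kappa> (f x)) = (if f x \<in> a then b else {})"
        using sets.sets_into_space[of b B] sets_eq_imp_space_eq[OF sets_\<kappa>[OF u]] by (auto simp: W)
      finally show "emeasure (\<kappa> (f x)) b * indicator a (f x) =
          emeasure (distr (\<kappa> (f x)) (A \<Otimes>\<^sub>M B) (\<lambda>y. (f x, y))) W"
        by simp
    qed
    also have "\<dots> = (\<integral>\<^sup>+ u. emeasure (distr (\<kappa> u) (A \<Otimes>\<^sub>M B) (\<lambda>y. (u, y))) W \<partial>distr P A f)"
      using measurable_emeasure_kernel[OF measurable_prob_algebraD[OF k], of W]
      by (subst nn_integral_distr) (auto simp: W)
    also have "\<dots> = emeasure ?R W"
      by (rule emeasure_bind[symmetric, OF ne]) (use measurable_prob_algebraD[OF k] in \<open>auto simp: W\<close>)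
    finally show "emeasure ?L W = emeasure ?R W" .
  qed (auto dest: sets.sets_into_space)
qed

locale Polish_stages =
  fixes T :: nat and X :: "nat \<Rightarrow> 'a topology"
  assumes Polish: "\<And>t. t \<in> {1..T} \<Longrightarrow> Polish_space (X t)"
begin

lemma sets_path_space:
  assumes "I \<subseteq> {1..T}"
  shows "sets (path_space X I) = sets (\<Pi>\<^sub>M i\<in>I. borel_of (X i))"
  unfolding path_space_def
proof (rule sets_borel_of_product_topology)
  show "finite I" using assms by (rule finite_subset) simp
qed (use assms Polish Polish_imp_second_countable in blast)

lemma measurable_restrict_path_space:
  assumes "J \<subseteq> I" "I \<subseteq> {1..T}"
  shows "(\<lambda>x. restrict x J) \<in> path_space X I \<rightarrow>\<^sub>M path_space X J"
proof -
  have "J \<subseteq> {1..T}" using assms by blast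
  note sets_path_space[OF \<open>I \<subseteq> {1..T}\<close>] sets_path_space[OF this]
  from measurable_cong_sets[OF this] show ?thesis
    using measurable_restrict_subset[OF \<open>J \<subseteq> I\<close>, of "\<lambda>i. borel_of (X i)"] by simp
qed

lemma measurable_merge_path_space:
  assumes "t \<le> T"
  shows "merge {1..t} {Suc t..T} \<in> path_space X {1..t} \<Otimes>\<^sub>M path_space X {Suc t..T} \<rightarrow>\<^sub>M path_space X {1..T}"
proof -
  have sub: "{1..t} \<subseteq> {1..T}" "{Suc t..T} \<subseteq> {1..T}" and un: "{1..t} \<union> {Suc t..T} = {1..T}"
    using \<open>t \<le> T\<close> by auto
  have sets: "sets (path_space X I) = sets (\<Pi>\<^sub>M i\<in>I. borel_of (X i))" if "I \<subseteq> {1..T}" for I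
    by (rule sets_path_space[OF that])
  from measurable_cong_sets[OF sets_pair_measure_cong[OF sets[OF sub(1)] sets[OF sub(2)]] sets[OF order_refl]]
  show ?thesis
    using measurable_merge[of "{1..t}" "{Suc t..T}" "\<lambda>i. borel_of (X i)"] unfolding un by simp
qed

text \<open>Disintegration of null sets: what holds for almost every path holds, for almost every initial
segment, for almost every continuation under the conditional law. This transports almost sure
inequalities between costs into the one-step conditional risk.\<close>

lemma AE_regular_conditional_prob:
  assumes P: "prob_space P" "sets P = sets (path_space X {1..T})"
    and \<kappa>: "regular_conditional_prob P X T t \<kappa>" and "t \<le> T"
    and R: "AE x in P. R x"
  shows "AE x in P. AE y in \<kappa> (restrict x {1..t}). R (merge {1..t} {Suc t..T} (x, y))"
proof -
  let ?A = "path_space X {1..t}" and ?B = "path_space X {Suc t..T}"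
  let ?f = "\<lambda>x. restrict x {1..t}" and ?g = "\<lambda>x. restrict x {Suc t..T}"
  have [measurable_cong]: "sets P = sets (path_space X {1..T})" by fact
  have f [measurable]: "?f \<in> P \<rightarrow>\<^sub>M ?A" and g [measurable]: "?g \<in> P \<rightarrow>\<^sub>M ?B"
    using \<open>t \<le> T\<close> by (auto simp: measurable_cong_sets[OF P(2) refl] intro!: measurable_restrict_path_space)
  have \<kappa>m [measurable]: "\<kappa> \<in> ?A \<rightarrow>\<^sub>M prob_algebra ?B"
    using \<kappa> by (simp add: regular_conditional_prob_def)
  have split: "distr P (?A \<Otimes>\<^sub>M ?B) (\<lambda>x. (?f x, ?g x)) =
      distr P ?A ?f \<bind> (\<lambda>u. distr (\<kappa> u) (?A \<Otimes>\<^sub>M ?B) (\<lambda>y. (u, y)))"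
    using \<kappa> by (intro distr_split_eq_bind P f g \<kappa>m) (simp add: regular_conditional_prob_def)
  have k: "(\<lambda>u. distr (\<kappa> u) (?A \<Otimes>\<^sub>M ?B) (\<lambda>y. (u, y))) \<in> ?A \<rightarrow>\<^sub>M subprob_algebra (?A \<Otimes>\<^sub>M ?B)"
    by (rule measurable_prob_algebraD) measurable
  obtain N where N: "{x \<in> space P. \<not> R x} \<subseteq> N" "N \<in> sets P" "emeasure P N = 0"
    using R by (auto elim: AE_E)
  \<comment> \<open>The null set is read as a set of pairs of an initial segment and a continuation.\<close>
  define C where "C = merge {1..t} {Suc t..T} -` N \<inter> space (?A \<Otimes>\<^sub>M ?B)"
  have [measurable]: "C \<in> sets (?A \<Otimes>\<^sub>M ?B)"
    unfolding C_def using N(2) P(2) by (intro measurable_sets[OF measurable_merge_path_space[OF \<open>t \<le> T\<close>]]) auto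
  have pred_C: "Measurable.pred (?A \<Otimes>\<^sub>M ?B) (\<lambda>p. p \<notin> C)"
    by measurable
  have "AE x in P. (?f x, ?g x) \<notin> C"
  proof -
    have "AE x in P. x \<notin> N" using N by (intro AE_not_in) auto
    then show ?thesis using AE_space
    proof eventually_elim
      case (elim x)
      have "x \<in> extensional {1..T}"
        using elim(2) sets_eq_imp_space_eq[OF P(2)] by (auto simp: path_space_def PiE_def)
      moreover have "{1..t} \<union> {Suc t..T} = {1..T}" using \<open>t \<le> T\<close> by auto
      ultimately have "merge {1..t} {Suc t..T} (?f x, ?g x) = x"
        by (simp only: merge_restrict merge_x_x_eq_restrict extensional_restrict)
      with elim(1) show ?case by (simp add: C_def)
    qed
  qed
  then have "AE p in distr P (?A \<Otimes>\<^sub>M ?B) (\<lambda>x. (?f x, ?g x)). p \<notin> C"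
    by (subst AE_distr_iff[OF measurable_Pair[OF f g] predE[OF pred_C]])
  then have "AE u in distr P ?A ?f. AE p in distr (\<kappa> u) (?A \<Otimes>\<^sub>M ?B) (\<lambda>y. (u, y)). p \<notin> C"
    unfolding split by (subst (asm) AE_bind[OF _ pred_C]) (simp_all only: measurable_distr_eq1 k)
  then have "AE x in P. AE p in distr (\<kappa> (?f x)) (?A \<Otimes>\<^sub>M ?B) (\<lambda>y. (?f x, y)). p \<notin> C"
    by (rule AE_distrD[OF f])
  then show ?thesis using AE_space
  proof eventually_elim
    case (elim x)
    have u: "?f x \<in> space ?A" using measurable_space[OF f elim(2)] .
    have sets_\<kappa>: "sets (\<kappa> (?f x)) = sets ?B"
      using measurable_space[OF \<kappa>m u] by (simp add: space_prob_algebra)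
    have "(\<lambda>y. (?f x, y)) \<in> \<kappa> (?f x) \<rightarrow>\<^sub>M ?A \<Otimes>\<^sub>M ?B"
      unfolding measurable_cong_sets[OF sets_\<kappa> refl] using u by (rule measurable_Pair1')
    from AE_distrD[OF this elim(1)] have "AE y in \<kappa> (?f x). (?f x, y) \<notin> C" .
    then show ?case using AE_space
    proof eventually_elim
      case y: (elim y)
      have p: "(?f x, y) \<in> space (?A \<Otimes>\<^sub>M ?B)"
        using u y(2) sets_eq_imp_space_eq[OF sets_\<kappa>] by (simp add: space_pair_measure)
      have "merge {1..t} {Suc t..T} (x, y) \<in> space P"
        using measurable_space[OF measurable_merge_path_space[OF \<open>t \<le> T\<close>] p]
          sets_eq_imp_space_eq[OF P(2)] by simp
      with N(1) y(1) p show ?case by (auto simp: C_def)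
    qed
  qed
qed

lemma measurable_stage_algebra_imp:
  fixes P :: "(nat \<Rightarrow> 'a) measure"
  assumes P: "sets P = sets (path_space X {1..T})" and "t \<le> T"
    and h: "h \<in> stage_algebra X T t \<rightarrow>\<^sub>M N"
  shows "h \<in> P \<rightarrow>\<^sub>M N"
proof -
  have "(\<lambda>x. x) \<in> P \<rightarrow>\<^sub>M stage_algebra X T t"
    unfolding stage_algebra_def
  proof (rule measurable_vimage_algebra2)
    show "(\<lambda>x. restrict x {1..t}) \<in> P \<rightarrow>\<^sub>M path_space X {1..t}"
      using \<open>t \<le> T\<close> by (auto simp: measurable_cong_sets[OF P refl] intro!: measurable_restrict_path_space)
  qed (simp add: sets_eq_imp_space_eq[OF P])
  from measurable_compose[OF this h] show ?thesis .
qed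

text \<open>Policies act on initial segments, not on whole paths; this turns an event known at time
\<open>t\<close> into a set of segments on which a policy can act.\<close>

lemma stage_algebra_eventE:
  assumes "t \<le> T"
    and "A \<in> sets (stage_algebra X T t)"
  obtains B where "B \<in> sets (path_space X {1..t})"
    "\<And>x. x \<in> space (path_space X {1..T}) \<Longrightarrow> x \<in> A \<longleftrightarrow> restrict x {1..t} \<in> B"
proof -
  have "(\<lambda>x. restrict x {1..t}) \<in> space (path_space X {1..T}) \<rightarrow> space (path_space X {1..t})"
    using measurable_space[OF measurable_restrict_path_space[of "{1..t}" "{1..T}"]] \<open>t \<le> T\<close> by simp
  then obtain B where "B \<in> sets (path_space X {1..t})"
    "A = (\<lambda>x. restrict x {1..t}) -` B \<inter> space (path_space X {1..T})"
    using assms(2) unfolding stage_algebra_def by (subst (asm) sets_vimage_algebra2) blast+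
  then show ?thesis by (intro that[of B]) auto
qed

text \<open>At each stage from \<open>r\<close> on the index is already known, and as it has only countably
many values the switched decision is measurable on each of the countably many pieces.\<close>

lemma adapted_policy_paste:
  assumes z: "\<And>k. adapted_policy X Z {r..T} (z k)"
    and n: "n \<in> path_space X {1..r} \<rightarrow>\<^sub>M count_space (UNIV :: nat set)"
  shows "adapted_policy X Z {r..T} (\<lambda>j w. z (n (restrict w {1..r})) j w)"
  unfolding adapted_policy_def
proof
  fix j assume j: "j \<in> {r..T}"
  show "(\<lambda>w. z (n (restrict w {1..r})) j w) \<in> path_space X {1..j} \<rightarrow>\<^sub>M borel_of (Z j)"
  proof (rule measurable_compose_countable[where f = "\<lambda>k. z k j"])
    show "z k j \<in> path_space X {1..j} \<rightarrow>\<^sub>M borel_of (Z j)" for k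
      using z j by (auto simp: adapted_policy_def)
    show "(\<lambda>w. n (restrict w {1..r})) \<in> path_space X {1..j} \<rightarrow>\<^sub>M count_space UNIV"
      using j by (intro measurable_compose[OF _ n] measurable_restrict_path_space) auto
  qed
qed

end

section \<open>The value process\<close>

locale multistage_problem = Polish_stages T X + prob_space P
  for T and X :: "nat \<Rightarrow> 'a topology" and P :: "(nat \<Rightarrow> 'a) measure" +
  fixes Z :: "nat \<Rightarrow> 'b topology"
    and K :: "nat \<Rightarrow> (nat \<Rightarrow> 'a) \<Rightarrow> (nat \<Rightarrow> 'a) measure"
    and S :: "nat \<Rightarrow> (real \<Rightarrow> real) set"
    and Q :: "(nat \<Rightarrow> 'b) \<times> (nat \<Rightarrow> 'a) \<Rightarrow> ereal"
  assumes sets_P: "sets P = sets (path_space X {1..T})"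
    and cond_prob: "\<And>t. t < T \<Longrightarrow> regular_conditional_prob P X T t (K t)"
    and nested_risk_measurable: "\<And>z t. adapted_policy X Z {0..T} z \<Longrightarrow> t \<le> T \<Longrightarrow>
      nested_risk T K S t T (policy_cost T Q z) \<in> borel_measurable (stage_algebra X T t)"
begin

abbreviation stage_value :: "(nat \<Rightarrow> (nat \<Rightarrow> 'a) \<Rightarrow> 'b) \<Rightarrow> nat \<Rightarrow> (nat \<Rightarrow> 'a) \<Rightarrow> ereal" where
  "stage_value z t \<equiv> value_process T X Z P K S Q z t"

text \<open>The random variables whose essential infimum is the value: \<open>z'\<close> takes over from
\<open>z\<close> at time \<open>t\<close>.\<close>

definition continuation_risk ::
    "(nat \<Rightarrow> (nat \<Rightarrow> 'a) \<Rightarrow> 'b) \<Rightarrow> nat \<Rightarrow> (nat \<Rightarrow> (nat \<Rightarrow> 'a) \<Rightarrow> 'b) \<Rightarrow> (nat \<Rightarrow> 'a) \<Rightarrow> ereal" where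
  "continuation_risk z t z' = nested_risk T K S t T (policy_cost T Q (\<lambda>j. if j < t then z j else z' j))"

lemma continuation_risk_measurable:
  assumes "adapted_policy X Z {0..T} z" "adapted_policy X Z {t..T} z'" "t \<le> T"
  shows "continuation_risk z t z' \<in> borel_measurable (stage_algebra X T t)"
  unfolding continuation_risk_def using assms
  by (intro nested_risk_measurable) (auto simp: adapted_policy_def)

text \<open>The value is some version of the essential infimum, selected by the choice operator. As one
version is the infimum of countably many members, every version is, up to a null set.\<close>

lemma value_attained_by_countable_subfamily:
  assumes z: "adapted_policy X Z {0..T} z" and "t \<le> T"
  shows value_is_ess_inf: "is_ess_inf P (stage_algebra X T t)
      {continuation_risk z t z' | z'. adapted_policy X Z {t..T} z'} (stage_value z t)"
    and ex_minimizing_sequence: "\<exists>f. (\<forall>n::nat. adapted_policy X Z {t..T} (f n)) \<and>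
      (AE x in P. (INF n. continuation_risk z t (f n) x) \<le> stage_value z t x)"
proof -
  let ?F = "stage_algebra X T t" and ?N = "continuation_risk z t"
  let ?Y = "{?N z' | z'. adapted_policy X Z {t..T} z'}"
  have "adapted_policy X Z {t..T} z" using z by (auto simp: adapted_policy_def)
  then have ne: "?Y \<noteq> {}" and sub: "?Y \<subseteq> borel_measurable ?F"
    using continuation_risk_measurable[OF z _ \<open>t \<le> T\<close>] by auto
  obtain g where g: "\<And>n::nat. g n \<in> ?Y" and g_inf: "is_ess_inf P ?F ?Y (\<lambda>x. INF n. g n x)"
    by (rule ess_inf_attained_by_countable_subfamily
        [OF measurable_stage_algebra_imp[OF sets_P \<open>t \<le> T\<close>] sub ne]) (assumption, rule that)
  show v: "is_ess_inf P ?F ?Y (stage_value z t)"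
    unfolding value_process_def ess_inf_def continuation_risk_def[symmetric]
    using someI[where P = "is_ess_inf P ?F ?Y", OF g_inf] by simp
  have "\<exists>z'. adapted_policy X Z {t..T} z' \<and> g n = ?N z'" for n using g[of n] by blast
  then obtain f where f: "\<And>n. adapted_policy X Z {t..T} (f n)" "\<And>n. g n = ?N (f n)" by metis
  have "AE x in P. (INF n. ?N (f n) x) \<le> stage_value z t x"
    using g_inf v unfolding f(2) is_ess_inf_def by simp
  with f(1) show "\<exists>f. (\<forall>n::nat. adapted_policy X Z {t..T} (f n)) \<and>
      (AE x in P. (INF n. ?N (f n) x) \<le> stage_value z t x)" by blast
qed

lemma value_le_continuation_risk:
  assumes "adapted_policy X Z {0..T} z" "adapted_policy X Z {t..T} z'" "t \<le> T"
  shows "AE x in P. stage_value z t x \<le> continuation_risk z t z' x"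
  using value_is_ess_inf[OF assms(1,3)] assms(2) by (auto simp: is_ess_inf_def)

lemma value_measurable:
  assumes "adapted_policy X Z {0..T} z" "t \<le> T"
  shows "stage_value z t \<in> borel_measurable (stage_algebra X T t)"
  using value_is_ess_inf[OF assms] by (simp add: is_ess_inf_def)

text \<open>A minimising sequence of continuations is pasted: on each path, the first one that is within
\<open>e\<close> of the value is followed. Which one that is, is known at time \<open>t\<close>, so
the pasted policy is adapted, and locality of the nested risk makes it \<open>e\<close>-optimal on
almost all paths simultaneously. At paths of value \<open>-\<infinity>\<close> no index need come
within \<open>e\<close>, hence the hypothesis that such paths are negligible.\<close>

lemma ex_nearly_optimal_continuation:
  assumes z: "adapted_policy X Z {0..T} z" and "t \<le> T"
    and fin: "AE x in P. stage_value z t x \<noteq> -\<infinity>" and "0 < e"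
  obtains z' where "adapted_policy X Z {t..T} z'"
    "AE x in P. continuation_risk z t z' x \<le> stage_value z t x + ereal e"
proof -
  let ?F = "stage_algebra X T t" and ?N = "continuation_risk z t" and ?v = "stage_value z t"
  obtain f where f: "\<And>n::nat. adapted_policy X Z {t..T} (f n)"
    and inf: "AE x in P. (INF n. ?N (f n) x) \<le> ?v x"
    using ex_minimizing_sequence[OF z \<open>t \<le> T\<close>] by blast
  have [measurable]: "?v \<in> borel_measurable ?F" by (rule value_measurable[OF z \<open>t \<le> T\<close>])
  have [measurable]: "?N (f n) \<in> borel_measurable ?F" for n
    by (rule continuation_risk_measurable[OF z f \<open>t \<le> T\<close>])
  define A where "A n = {x \<in> space ?F. ?N (f n) x \<le> ?v x + ereal e}" for n
  have A: "A n \<in> sets ?F" for n unfolding A_def by measurable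
  have space: "space ?F = space (path_space X {1..T})" by (simp add: stage_algebra_def)
  have "\<exists>B. B \<in> sets (path_space X {1..t}) \<and>
    (\<forall>x \<in> space (path_space X {1..T}). x \<in> A n \<longleftrightarrow> restrict x {1..t} \<in> B)" for n
    by (rule stage_algebra_eventE[OF \<open>t \<le> T\<close> A[of n]]) blast+
  then obtain B where [measurable]: "\<And>n. B n \<in> sets (path_space X {1..t})"
    and B: "\<And>n x. x \<in> space (path_space X {1..T}) \<Longrightarrow> x \<in> A n \<longleftrightarrow> restrict x {1..t} \<in> B n"
    by metis
  \<comment> \<open>On the null set where no index qualifies the value of \<open>LEAST\<close> is arbitrary but
    still depends measurably on the path.\<close>
  define n where "n w = (LEAST k. w \<in> B k)" for w
  have n: "n \<in> path_space X {1..t} \<rightarrow>\<^sub>M count_space UNIV"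
    unfolding n_def by measurable
  define z' where "z' = (\<lambda>j w. f (n (restrict w {1..t})) j w)"
  have paste: "?N z' x = ?N (f (n (restrict x {1..t}))) x" for x
    unfolding continuation_risk_def
  proof (rule nested_risk_cong[OF \<open>t \<le> T\<close>])
    fix x' assume eq: "restrict x' {1..t} = restrict x {1..t}"
    have "z' j (restrict x' {1..j}) = f (n (restrict x {1..t})) j (restrict x' {1..j})" if "t \<le> j" for j
    proof -
      have "{1..j} \<inter> {1..t} = {1..t}" using that by auto
      then show ?thesis by (simp only: z'_def restrict_restrict eq)
    qed
    then show "policy_cost T Q (\<lambda>j. if j < t then z j else z' j) x' =
        policy_cost T Q (\<lambda>j. if j < t then z j else f (n (restrict x {1..t})) j) x'"
      unfolding policy_cost_def by (intro arg_cong[where f = Q] prod_eqI restrict_ext) auto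
  qed
  have nearly_optimal: "AE x in P. ?N z' x \<le> ?v x + ereal e"
    using inf fin AE_space
  proof eventually_elim
    case (elim x)
    have x: "x \<in> space (path_space X {1..T})"
      using elim(3) sets_eq_imp_space_eq[OF sets_P] by simp
    have "\<exists>k. ?N (f k) x \<le> ?v x + ereal e"
    \<comment> \<open>If the value is \<open>\<infinity>\<close>, every continuation is nearly optimal.\<close>
    proof (cases "?v x")
      case (real r)
      have "?v x < ?v x + ereal e" using \<open>0 < e\<close> by (simp add: real)
      with elim(1) have "(INF k. ?N (f k) x) < ?v x + ereal e" by (rule le_less_trans)
      then show ?thesis by (auto simp: INF_less_iff intro: less_imp_le)
    qed (use elim(2) in auto)
    then obtain k where "x \<in> A k" using x by (auto simp: A_def space)
    then have "restrict x {1..t} \<in> B k" using B[OF x] by simp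
    then have "restrict x {1..t} \<in> B (n (restrict x {1..t}))"
      unfolding n_def by (rule LeastI)
    then have "x \<in> A (n (restrict x {1..t}))" using B[OF x] by simp
    then show ?case by (simp add: A_def paste)
  qed
  have "adapted_policy X Z {t..T} z'"
    unfolding z'_def by (rule adapted_policy_paste[OF f n])
  from this nearly_optimal show ?thesis by (rule that)
qed

text \<open>Keeping the decision of \<open>z\<close> at time \<open>t\<close> and continuing
\<open>e\<close>-optimally afterwards is one of the policies competing in the value at time
\<open>t\<close>; its nested risk is the one-step risk of an \<open>e\<close>-optimal cost.\<close>

lemma value_le_cond_risk_value_add:
  assumes z: "adapted_policy X Z {0..T} z" and t: "t < T"
    and fin: "AE x in P. stage_value z (Suc t) x \<noteq> -\<infinity>" and "0 < e"
  shows "AE x in P. stage_value z t x \<le> cond_risk T K S t (stage_value z (Suc t)) x + ereal e"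
proof -
  have "t \<le> T" "Suc t \<le> T" using t by auto
  obtain z' where z': "adapted_policy X Z {Suc t..T} z'"
    and near: "AE x in P. continuation_risk z (Suc t) z' x \<le> stage_value z (Suc t) x + ereal e"
    by (rule ex_nearly_optimal_continuation[OF z \<open>Suc t \<le> T\<close> fin \<open>0 < e\<close>]) (rule that)
  define y where "y = (\<lambda>j. if j < Suc t then z j else z' j)"
  have "adapted_policy X Z {t..T} y"
    using z z' by (auto simp: adapted_policy_def y_def)
  then have below: "AE x in P. stage_value z t x \<le> continuation_risk z t y x"
    by (rule value_le_continuation_risk[OF z _ \<open>t \<le> T\<close>])
  have risk_eq: "continuation_risk z t y = cond_risk T K S t (continuation_risk z (Suc t) z')"
  proof -
    have "(\<lambda>j. if j < t then z j else y j) = y" by (auto simp: y_def)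
    then show ?thesis
      by (simp only: continuation_risk_def y_def[symmetric]) (rule ext, rule nested_risk_Suc[OF t, THEN fun_cong])
  qed
  have "AE x in P. AE y in K t (restrict x {1..t}).
      continuation_risk z (Suc t) z' (merge {1..t} {Suc t..T} (x, y))
        \<le> stage_value z (Suc t) (merge {1..t} {Suc t..T} (x, y)) + ereal e"
    by (rule AE_regular_conditional_prob[OF prob_space_axioms sets_P cond_prob[OF t] \<open>t \<le> T\<close> near])
  with below show ?thesis using AE_space
  proof eventually_elim
    case (elim x)
    have u: "restrict x {1..t} \<in> space (path_space X {1..t})"
      using measurable_space[OF measurable_restrict_path_space[of "{1..t}" "{1..T}"]] elim(3)
        \<open>t \<le> T\<close> sets_eq_imp_space_eq[OF sets_P] by auto
    have "K t \<in> path_space X {1..t} \<rightarrow>\<^sub>M prob_algebra (path_space X {Suc t..T})"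
      using cond_prob[OF t] by (simp add: regular_conditional_prob_def)
    from measurable_space[OF this u]
    have sets_K: "sets (K t (restrict x {1..t})) = sets (path_space X {Suc t..T})"
      by (simp add: space_prob_algebra)
    \<comment> \<open>Restricting \<open>x\<close> changes nothing but places the first component in the initial path
      space, so that joint measurability of concatenation applies.\<close>
    have "(\<lambda>y. stage_value z (Suc t) (merge {1..t} {Suc t..T} (restrict x {1..t}, y)))
        \<in> borel_measurable (path_space X {Suc t..T})"
    proof (rule measurable_compose[where g = "stage_value z (Suc t)"])
      show "(\<lambda>y. merge {1..t} {Suc t..T} (restrict x {1..t}, y)) \<in> path_space X {Suc t..T} \<rightarrow>\<^sub>M path_space X {1..T}"
        using u by (intro measurable_compose[OF _ measurable_merge_path_space[OF \<open>t \<le> T\<close>]]) simp_all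
      show "stage_value z (Suc t) \<in> borel_measurable (path_space X {1..T})"
        by (rule measurable_stage_algebra_imp[OF refl \<open>Suc t \<le> T\<close> value_measurable[OF z \<open>Suc t \<le> T\<close>]])
    qed
    then have "(\<lambda>y. stage_value z (Suc t) (merge {1..t} {Suc t..T} (x, y))) \<in> borel_measurable (K t (restrict x {1..t}))"
      by (simp only: merge_restrict measurable_cong_sets[OF sets_K refl])
    then have "cond_risk T K S t (continuation_risk z (Suc t) z') x
        \<le> cond_risk T K S t (stage_value z (Suc t)) x + ereal e"
      using elim(2) \<open>0 < e\<close>
      by (intro cond_risk_le_add[where Y' = "stage_value z (Suc t)"]) (assumption+, simp)
    with elim(1) show ?case unfolding risk_eq by (rule order_trans)
  qed
qed

end

theorem theorem46:
  fixes T :: nat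
    and X :: "nat \<Rightarrow> 'a topology" and Z :: "nat \<Rightarrow> 'b topology"
    and P :: "(nat \<Rightarrow> 'a) measure"
    and K :: "nat \<Rightarrow> (nat \<Rightarrow> 'a) \<Rightarrow> (nat \<Rightarrow> 'a) measure"
    and S :: "nat \<Rightarrow> (real \<Rightarrow> real) set"
    and Q :: "(nat \<Rightarrow> 'b) \<times> (nat \<Rightarrow> 'a) \<Rightarrow> ereal"
    and z :: "nat \<Rightarrow> (nat \<Rightarrow> 'a) \<Rightarrow> 'b"
  assumes T: "1 \<le> T"
    and Polish: "\<And>t. t \<in> {1..T} \<Longrightarrow> Polish_space (X t)"
    and P: "prob_space P" "sets P = sets (path_space X {1..T})"
    and K: "\<And>t. t < T \<Longrightarrow> regular_conditional_prob P X T t (K t)"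
    and S: "\<And>t \<sigma>. t \<in> {1..T} \<Longrightarrow> \<sigma> \<in> S t \<Longrightarrow> distortion_function \<sigma>"
    and Q_lsc: "lower_semicontinuous_map
                  (prod_topology (product_topology Z {0..T}) (product_topology X {1..T})) Q"
    and Q_range: "\<And>w x. w \<in> topspace (product_topology Z {0..T}) \<Longrightarrow>
                    x \<in> topspace (product_topology X {1..T}) \<Longrightarrow> Q (w, x) \<noteq> -\<infinity>"
    and risks_well_defined: "\<And>z' t. adapted_policy X Z {0..T} z' \<Longrightarrow> t \<le> T \<Longrightarrow>
          nested_risk T K S t T (policy_cost T Q z') \<in> borel_measurable (stage_algebra X T t)"
    and policy: "adapted_policy X Z {0..T} z"
    and values_well_defined: "\<And>t. t \<in> {1..T} \<Longrightarrow>
          AE x in P. value_process T X Z P K S Q z t x \<noteq> -\<infinity>"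
  shows "risk_submartingale T P K S (value_process T X Z P K S Q z)"
proof -
  interpret multistage_problem T X P Z K S Q
    using Polish P K risks_well_defined
    by (intro multistage_problem.intro Polish_stages.intro multistage_problem_axioms.intro)
  show ?thesis
    unfolding risk_submartingale_def
  proof (intro allI impI)
    fix t assume t: "t < T"
    have "AE x in P. stage_value z t x \<le> cond_risk T K S t (stage_value z (Suc t)) x + ereal (1 / real (Suc n))" for n
      using t by (intro value_le_cond_risk_value_add policy values_well_defined) auto
    then have "AE x in P. \<forall>n. stage_value z t x \<le> cond_risk T K S t (stage_value z (Suc t)) x + ereal (1 / real (Suc n))"
      unfolding AE_all_countable by (rule allI)
    then show "AE x in P. stage_value z t x \<le> cond_risk T K S t (stage_value z (Suc t)) x"
    proof eventually_elim
      case (elim x)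
      show ?case
      proof (rule ereal_le_epsilon2)
        fix e :: real assume "0 < e"
        then obtain n :: nat where n: "1 / real (Suc n) < e" by (rule nat_approx_posE)
        have "stage_value z t x \<le> cond_risk T K S t (stage_value z (Suc t)) x + ereal (1 / real (Suc n))"
          using elim by (rule spec)
        also have "\<dots> \<le> cond_risk T K S t (stage_value z (Suc t)) x + ereal e"
          using n by (intro add_left_mono) simp
        finally show "stage_value z t x \<le> cond_risk T K S t (stage_value z (Suc t)) x + ereal e" .
      qed
    qed
  qed
qed

end
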